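(* Let $G=(V,E)$ be a finite simple graph and let $1\le k\le |V|$. Then \[ \varepsilon_k(G)\le \binom{k}{2}+(4k-2)\sqrt{k}. \]
   Context: The Laplacian matrix $L(G)\in\mathbb{R}^{V\times V}$ of a graph $G=(V,E)$ has $L(G)_{u,u}=\deg(u)$, $L(G)_{u,v}=-1$ if $\{u,v\}\in E$, and $0$ otherwise. For a symmetric matrix $M$, $\lambda_i(M)$ denotes its $i$-th largest eigenvalue. Define $\varepsilon_k(G)=\sum_{i=1}^k\lambda_i(L(G))-|E|$. *)

theory Defs
  imports "HOL-Analysis.Analysis" "HOL-Library.Multiset"
begin

text \<open>The vertex set of a graph is the finite type \<^typ>\<open>'v\<close>; a graph is given by its edge set.\<close>

definition simple_graph :: "'v::finite set set \<Rightarrow> bool" where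
  "simple_graph E \<longleftrightarrow> (\<forall>e\<in>E. card e = 2)"

definition graph_degree :: "'v::finite set set \<Rightarrow> 'v \<Rightarrow> nat" where
  "graph_degree E u = card {e \<in> E. u \<in> e}"

definition laplacian :: "'v::finite set set \<Rightarrow> real ^ 'v ^ 'v" where
  "laplacian E =
     (\<chi> u v. if u = v then real (graph_degree E u) else if {u, v} \<in> E then - 1 else 0)"

definition eigenspace :: "real ^ 'n ^ 'n \<Rightarrow> real \<Rightarrow> (real ^ 'n) set" where
  "eigenspace M c = {x. M *v x = c *\<^sub>R x}"

definition eigenvalues :: "real ^ 'n ^ 'n \<Rightarrow> real set" where
  "eigenvalues M = {c. \<exists>x. x \<noteq> 0 \<and> M *v x = c *\<^sub>R x}"

text \<open>Every eigenvalue is counted with its geometric multiplicity. For the symmetric matrices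
  considered here this is also its algebraic multiplicity, and the multiset has size
  \<^term>\<open>CARD('n)\<close>.\<close>

definition spectrum_mset :: "real ^ 'n ^ 'n \<Rightarrow> real multiset" where
  "spectrum_mset M = (\<Sum>c\<in>eigenvalues M. replicate_mset (dim (eigenspace M c)) c)"

text \<open>The \<open>i\<close>-th largest eigenvalue, with \<open>i\<close> starting at 1.\<close>

definition eigval :: "nat \<Rightarrow> real ^ 'n ^ 'n \<Rightarrow> real" where
  "eigval i M = rev (sorted_list_of_multiset (spectrum_mset M)) ! (i - 1)"

definition lap_excess :: "nat \<Rightarrow> 'v::finite set set \<Rightarrow> real" where
  "lap_excess k E = (\<Sum>i=1..k. eigval i (laplacian E)) - real (card E)"

end

theory Submission
  imports Defs
begin

text \<open>Let \<open>P = (p u v)\<close> be the orthogonal projection onto the span of orthonormal eigenvectors for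
  the \<open>k\<close> largest eigenvalues, \<open>d\<^sub>u = p u u\<close> and \<open>a\<^sub>u = 1 - d\<^sub>u\<close>. The excess is the trace of \<open>L P\<close>
  minus the number of edges, that is the sum over the edges \<open>uv\<close> of
  \<open>d\<^sub>u + d\<^sub>v - 1 - 2 p\<^sub>u\<^sub>v = (d\<^sub>u d\<^sub>v - p\<^sub>u\<^sub>v\<^sup>2) + (p\<^sub>u\<^sub>v\<^sup>2 - 2 p\<^sub>u\<^sub>v - a\<^sub>u a\<^sub>v)\<close>.
  The first bracket is a principal minor of \<open>P\<close>, hence nonnegative, and its sum over all pairs is
  \<open>k choose 2\<close>. Since \<open>p\<^sub>u\<^sub>v\<^sup>2 \<le> a\<^sub>u a\<^sub>v\<close> (a principal minor of \<open>1 - P\<close>), the second one is at most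
  \<open>2 \<bar>p\<^sub>u\<^sub>v\<bar>\<close>; over the pairs among the fewer than \<open>2 k\<close> vertices with \<open>d\<^sub>u > 1/2\<close> this sums
  to \<open>O(k\<^sup>3\<^sup>/\<^sup>2)\<close> by Cauchy-Schwarz. For the remaining pairs AM-GM bounds it
  by \<open>p\<^sub>u\<^sub>v\<^sup>2 (1 + 1 / (a\<^sub>u a\<^sub>v))\<close>, and because every off-diagonal row sum of squares is \<open>d\<^sub>u a\<^sub>u\<close>, these
  terms contribute only \<open>O(k)\<close>.\<close>

section \<open>Eigenbases of self-adjoint maps\<close>

text \<open>A maximiser of the Rayleigh quotient on the unit sphere of \<open>W\<close> is an
  eigenvector: the residual \<open>f x - c x\<close> lies in \<open>W\<close> and is the first
  variation there, so it has to vanish.\<close>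

lemma selfadjoint_eigenvector_in_subspace:
  fixes f :: "'a::euclidean_space \<Rightarrow> 'a"
  assumes f: "linear f" and adj: "\<And>x y. f x \<bullet> y = x \<bullet> f y"
    and W: "subspace W" and inv: "\<And>x. x \<in> W \<Longrightarrow> f x \<in> W" and ne: "\<exists>w\<in>W. w \<noteq> 0"
  obtains x c where "x \<in> W" "x \<noteq> 0" "f x = c *\<^sub>R x"
proof -
  let ?S = "W \<inter> sphere 0 1"
  have "compact ?S"
    using closed_Int_compact[OF closed_subspace[OF W] compact_sphere] .
  moreover from ne obtain w where w: "w \<in> W" "w \<noteq> 0" by blast
  then have "(1 / norm w) *\<^sub>R w \<in> ?S"
    using W by (simp add: subspace_scale)
  then have "?S \<noteq> {}" by blast
  moreover have "continuous_on ?S (\<lambda>x. x \<bullet> f x)"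
    by (intro continuous_intros linear_continuous_on) (use f linear_conv_bounded_linear in blast)
  ultimately obtain x where x: "x \<in> ?S" and max: "\<And>y. y \<in> ?S \<Longrightarrow> y \<bullet> f y \<le> x \<bullet> f x"
    using continuous_attains_sup by metis
  define c where "c = x \<bullet> f x"
  have xx: "x \<bullet> x = 1" and xW: "x \<in> W" using x by (auto simp: norm_eq_1)
  have rayleigh: "y \<bullet> f y \<le> c * (y \<bullet> y)" if "y \<in> W" for y
  proof (cases "y = 0")
    case False
    then have "(1 / norm y) *\<^sub>R y \<in> ?S"
      using W that by (simp add: subspace_scale)
    from max[OF this] have "(y \<bullet> f y) / (norm y)\<^sup>2 \<le> c"
      by (simp add: c_def linear_scale[OF f] power2_eq_square)
    then show ?thesis using False
      by (simp add: divide_le_eq power2_norm_eq_inner)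
  qed (simp add: linear_0[OF f])
  define g where "g = f x - c *\<^sub>R x"
  have gW: "g \<in> W" using W inv xW by (simp add: g_def subspace_diff subspace_scale)
  have "g \<bullet> g = 0"
  proof (rule ccontr)
    assume "g \<bullet> g \<noteq> 0"
    then have pos: "g \<bullet> g > 0" by simp
    \<comment> \<open>Moving from \<open>x\<close> to \<open>x + t g\<close> gains
      \<open>2 t (g \<bullet> g)\<close> to first order and loses \<open>t\<^sup>2 b\<close> to
      second order. Maximality forbids a net gain; \<open>t = 1\<close> gives \<open>b > 0\<close>,
      and \<open>t = (g \<bullet> g) / b\<close> is then contradictory.\<close>
    define b where "b = c * (g \<bullet> g) - g \<bullet> f g"
    have var: "2 * t * (g \<bullet> g) \<le> t\<^sup>2 * b" for t
    proof -
      have "x + t *\<^sub>R g \<in> W" using W xW gW by (simp add: subspace_add subspace_scale)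
      from rayleigh[OF this]
      have "c + 2 * t * (g \<bullet> f x) + t\<^sup>2 * (g \<bullet> f g) \<le> c * (1 + 2 * t * (g \<bullet> x) + t\<^sup>2 * (g \<bullet> g))"
        using adj[of x g]
        by (simp add: linear_add[OF f] linear_scale[OF f] inner_add_left inner_add_right xx
            c_def[symmetric] inner_commute power2_eq_square algebra_simps)
      moreover have "g \<bullet> g = g \<bullet> f x - c * (g \<bullet> x)"
        by (subst (2) g_def) (simp add: inner_diff_right)
      then have "2 * t * (g \<bullet> g) = 2 * t * (g \<bullet> f x) - c * (2 * t * (g \<bullet> x))"
        by (simp add: right_diff_distrib)
      ultimately show ?thesis by (simp add: b_def ring_distribs mult.left_commute)
    qed
    have "2 * (g \<bullet> g) \<le> b" using var[of 1] by simp
    then have b: "b > 0" using pos by linarith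
    then have "(g \<bullet> g / b)\<^sup>2 * b = g \<bullet> g / b * (g \<bullet> g)" by (simp add: power2_eq_square)
    moreover have "0 < g \<bullet> g / b * (g \<bullet> g)" using pos b by (intro mult_pos_pos divide_pos_pos)
    ultimately show False using var[of "g \<bullet> g / b"] by linarith
  qed
  then have "f x = c *\<^sub>R x" by (simp add: g_def)
  with xW xx show thesis using that by force
qed

lemma selfadjoint_eigenvectors_orthogonal:
  fixes f :: "'a::real_inner \<Rightarrow> 'a"
  assumes "\<And>x y. f x \<bullet> y = x \<bullet> f y" "f x = b *\<^sub>R x" "f y = c *\<^sub>R y" "b \<noteq> c"
  shows "x \<bullet> y = 0"
  using assms(1)[of x y] assms(2-4) by simp

lemma subspace_eigenspace: "subspace (eigenspace M c)"
proof (rule subspaceI)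
  fix x y a assume "x \<in> eigenspace M c" "y \<in> eigenspace M c"
  then show "x + y \<in> eigenspace M c" "a *\<^sub>R x \<in> eigenspace M c"
    by (simp_all add: eigenspace_def matrix_vector_right_distrib scaleR_add_right
        matrix_vector_mult_scaleR scaleR_left_commute)
qed (simp add: eigenspace_def)

lemma symmetric_matrix_adjoint:
  fixes M :: "real ^ 'n ^ 'n"
  assumes "transpose M = M"
  shows "(M *v x) \<bullet> y = x \<bullet> (M *v y)"
  using dot_lmul_matrix[of x M y] transpose_matrix_vector[of M x] assms by simp

text \<open>Orthonormal bases of all eigenspaces are glued together, so that each eigenvalue occurs
  as often in the basis as in \<open>spectrum_mset\<close>.\<close>

lemma symmetric_eigenbasis:
  fixes M :: "real ^ 'n ^ 'n"
  assumes sym: "transpose M = M"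
  obtains B l where "finite B" "card B = CARD('n)" "pairwise orthogonal B"
    "\<And>x. x \<in> B \<Longrightarrow> norm x = 1" "\<And>x. x \<in> B \<Longrightarrow> M *v x = l x *\<^sub>R x"
    "spectrum_mset M = image_mset l (mset_set B)"
proof -
  note adj = symmetric_matrix_adjoint[OF sym]
  have "\<exists>B. B \<subseteq> eigenspace M c \<and> pairwise orthogonal B \<and> (\<forall>x\<in>B. norm x = 1) \<and> independent B
      \<and> card B = dim (eigenspace M c) \<and> span B = eigenspace M c" for c
    by (rule orthonormal_basis_subspace[OF subspace_eigenspace[of M c]]) blast
  then obtain b where b: "\<And>c. b c \<subseteq> eigenspace M c" "\<And>c. pairwise orthogonal (b c)"
      "\<And>c x. x \<in> b c \<Longrightarrow> norm x = 1" "\<And>c. independent (b c)"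
      "\<And>c. card (b c) = dim (eigenspace M c)" "\<And>c. span (b c) = eigenspace M c"
    by metis
  \<comment> \<open>The union runs over all reals; \<open>b c\<close> is empty unless
    \<open>c\<close> is an eigenvalue. As the basis vectors are units, the Rayleigh quotient
    \<open>l\<close> recovers the eigenvalue.\<close>
  define B where "B = (\<Union>c. b c)"
  define l where "l x = x \<bullet> (M *v x)" for x
  have bl: "M *v x = c *\<^sub>R x" "l x = c" if "x \<in> b c" for x c
    using b(1)[of c] b(3)[OF that] that by (auto simp: eigenspace_def l_def norm_eq_1)
  have b_iff: "x \<in> b c \<longleftrightarrow> x \<in> B \<and> l x = c" for x c
    using bl(2) unfolding B_def by blast
  have norm1: "norm x = 1" and eig: "M *v x = l x *\<^sub>R x" if "x \<in> B" for x
    using that b(3) bl unfolding B_def by auto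
  have orth: "pairwise orthogonal B"
  proof (rule pairwiseI)
    fix x y assume xy: "x \<in> B" "y \<in> B" "x \<noteq> y"
    show "orthogonal x y"
    proof (cases "l x = l y")
      case True
      then show ?thesis using xy b(2)[of "l x"] b_iff by (metis pairwiseD)
    next
      case False
      then show ?thesis
        using selfadjoint_eigenvectors_orthogonal[of "(*v) M", OF adj eig eig] xy
        by (simp add: orthogonal_def)
    qed
  qed
  have "0 \<notin> B" using norm1 by force
  then have indep: "independent B" using orth pairwise_orthogonal_independent by blast
  then have finB: "finite B" using independent_imp_finite by blast
  define W where "W = {x. \<forall>y\<in>span B. orthogonal y x}"
  have W: "x \<in> W \<longleftrightarrow> (\<forall>y\<in>B. y \<bullet> x = 0)" for x
    unfolding W_def orthogonal_def
    by (auto intro: span_base span_induct simp: subspace_def inner_add_left)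
  \<comment> \<open>Otherwise the orthogonal complement \<open>W\<close> of \<open>B\<close> is
    nonzero and invariant, hence contains an eigenvector. That vector also lies in
    \<open>span B\<close>, so it is orthogonal to itself.\<close>
  have "span B = UNIV"
  proof (rule ccontr)
    assume "span B \<noteq> UNIV"
    then have "span B \<subset> span UNIV" by auto
    then obtain w where "w \<noteq> 0" "\<And>y. y \<in> span B \<Longrightarrow> orthogonal w y"
      using orthogonal_to_subspace_exists_gen by metis
    then have "\<exists>w\<in>W. w \<noteq> 0" unfolding W_def using orthogonal_commute by blast
    moreover have "subspace W" by (auto simp: subspace_def W inner_add_right)
    moreover have "M *v x \<in> W" if "x \<in> W" for x
      using that unfolding W by (simp add: adj[symmetric] eig)
    ultimately obtain x c where x: "x \<in> W" "x \<noteq> 0" "M *v x = c *\<^sub>R x"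
      using selfadjoint_eigenvector_in_subspace[OF matrix_vector_mul_linear adj] by metis
    then have "x \<in> span B"
      using b(6)[of c] span_mono[of "b c" B] by (auto simp: eigenspace_def B_def)
    with x(1) have "orthogonal x x" unfolding W_def by blast
    with x(2) show False by (simp add: orthogonal_def)
  qed
  then have card: "card B = CARD('n)"
    using indep dim_eq_card[of B UNIV] by simp
  have ev: "eigenvalues M = l ` B"
  proof (intro equalityI subsetI)
    fix c assume "c \<in> eigenvalues M"
    then obtain x where x: "x \<noteq> 0" "x \<in> eigenspace M c"
      by (auto simp: eigenvalues_def eigenspace_def)
    then obtain y where "y \<in> b c" using b(6)[of c] by fastforce
    then show "c \<in> l ` B" using b_iff[of y c] by blast
  next
    fix c assume "c \<in> l ` B"
    then obtain x where "x \<in> B" "c = l x" by blast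
    then show "c \<in> eigenvalues M"
      using eig[of x] norm1[of x] by (auto simp: eigenvalues_def intro!: exI[of _ x])
  qed
  have "spectrum_mset M = image_mset l (mset_set B)"
  proof (rule multiset_eqI)
    fix c
    have "count (spectrum_mset M) c = (\<Sum>c'\<in>l ` B. if c = c' then card (b c') else 0)"
      unfolding spectrum_mset_def ev count_sum by (intro sum.cong) (auto simp: b(5))
    also have "\<dots> = card (b c)"
      using finB b_iff by (auto simp: sum.delta') (metis card.empty equals0I image_eqI)
    also have "b c = {x \<in> B. l x = c}" using b_iff by blast
    also have "card \<dots> = count (image_mset l (mset_set B)) c"
      using finB by (simp add: count_image_mset vimage_def Int_def conj_commute)
    finally show "count (spectrum_mset M) c = count (image_mset l (mset_set B)) c" .
  qed
  with finB card orth norm1 eig show thesis using that by blast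
qed

text \<open>Sorting the eigenbasis by descending eigenvalue aligns it with \<open>eigval\<close>;
  the vectors are indexed from 0, the eigenvalues from 1.\<close>

lemma symmetric_eigval_orthonormal:
  fixes M :: "real ^ 'n ^ 'n"
  assumes "transpose M = M"
  obtains x :: "nat \<Rightarrow> real ^ 'n" where
    "\<And>i j. i < CARD('n) \<Longrightarrow> j < CARD('n) \<Longrightarrow> x i \<bullet> x j = of_bool (i = j)"
    "\<And>i. i < CARD('n) \<Longrightarrow> M *v x i = eigval (Suc i) M *\<^sub>R x i"
proof -
  obtain B l where B: "finite B" "card B = CARD('n)" "pairwise orthogonal B"
    "\<And>x. x \<in> B \<Longrightarrow> norm x = 1" "\<And>x. x \<in> B \<Longrightarrow> M *v x = l x *\<^sub>R x"
    "spectrum_mset M = image_mset l (mset_set B)"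
    using symmetric_eigenbasis[OF assms] by blast
  obtain ys where dys: "set ys = B" "distinct ys" using finite_distinct_list[OF B(1)] by blast
  then have ys: "mset ys = mset_set B" by (metis mset_set_set)
  define xs where "xs = rev (sort_key l ys)"
  have dist: "distinct xs" and set: "set xs = B"
    using dys by (simp_all add: xs_def)
  then have len: "length xs = CARD('n)" by (metis B(2) distinct_card)
  have "sorted_list_of_multiset (spectrum_mset M) = sort (map l ys)"
    by (simp add: B(6) ys[symmetric] mset_map[symmetric] del: mset_map)
  also have "\<dots> = map l (sort_key l ys)"
    by (rule properties_for_sort) (simp_all)
  finally have "rev (sorted_list_of_multiset (spectrum_mset M)) = map l xs"
    by (simp add: xs_def rev_map)
  then have ev: "eigval (Suc i) M = l (xs ! i)" if "i < CARD('n)" for i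
    using that len by (simp add: eigval_def)
  show thesis
  proof (rule that[of "\<lambda>i. xs ! i"])
    fix i j assume ij: "i < CARD('n)" "j < CARD('n)"
    then have "xs ! i \<in> B" "xs ! j \<in> B" using set len by auto
    then show "xs ! i \<bullet> xs ! j = of_bool (i = j)"
      using B(3,4) dist ij len
      by (auto simp: norm_eq_1 pairwise_def orthogonal_def nth_eq_iff_index_eq)
  next
    fix i assume "i < CARD('n)"
    then show "M *v xs ! i = eigval (Suc i) M *\<^sub>R xs ! i"
      using B(5) set len ev by auto
  qed
qed

section \<open>Entries of a projection matrix\<close>

text \<open>A symmetric idempotent matrix is an orthogonal projection. As \<open>1 - p\<close> is
  again an instance, every bound on \<open>p\<close> also holds for the complement.\<close>

locale projection_matrix =
  fixes p :: "'v::finite \<Rightarrow> 'v \<Rightarrow> real"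
  assumes sym: "p u v = p v u"
    and idem: "(\<Sum>w\<in>UNIV. p u w * p w v) = p u v"
begin

lemma row_sum_squares: "(\<Sum>v\<in>UNIV. (p u v)\<^sup>2) = p u u"
proof -
  have "(\<Sum>v\<in>UNIV. (p u v)\<^sup>2) = (\<Sum>v\<in>UNIV. p u v * p v u)"
    by (intro sum.cong refl) (metis power2_eq_square sym)
  then show ?thesis by (simp add: idem)
qed

lemma diag_nonneg: "0 \<le> p u u"
  by (metis row_sum_squares sum_nonneg zero_le_power2)

text \<open>By idempotence \<open>p u v\<close> is the inner product of rows \<open>u\<close> and
  \<open>v\<close>, whose squared norms are diagonal entries; Cauchy-Schwarz applies.\<close>

lemma entry_square_le: "(p u v)\<^sup>2 \<le> p u u * p v v"
proof -
  have "(\<Sum>w\<in>UNIV. p u w * p w v)\<^sup>2 \<le> (\<Sum>w\<in>UNIV. (p u w)\<^sup>2) * (\<Sum>w\<in>UNIV. (p w v)\<^sup>2)"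
    by (rule Cauchy_Schwarz_ineq_sum)
  moreover have "(\<Sum>w\<in>UNIV. (p w v)\<^sup>2) = (\<Sum>w\<in>UNIV. (p v w)\<^sup>2)"
    by (intro sum.cong refl) (metis sym)
  ultimately show ?thesis by (simp add: idem row_sum_squares)
qed

lemma projection_matrix_complement: "projection_matrix (\<lambda>u v. of_bool (u = v) - p u v)"
proof
  fix u v
  show "of_bool (u = v) - p u v = of_bool (v = u) - p v u" using sym[of u v] by auto
  have "(\<Sum>w\<in>UNIV. (of_bool (u = w) - p u w) * (of_bool (w = v) - p w v))
      = (\<Sum>w\<in>UNIV. of_bool (u = w) * of_bool (w = v)) - (\<Sum>w\<in>UNIV. p u w * of_bool (w = v))
        - (\<Sum>w\<in>UNIV. of_bool (u = w) * p w v) + (\<Sum>w\<in>UNIV. p u w * p w v)"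
    by (simp add: algebra_simps sum.distrib sum_subtractf)
  also have "\<dots> = of_bool (u = v) - p u v"
    by (cases "u = v") (auto simp: idem)
  finally show "(\<Sum>w\<in>UNIV. (of_bool (u = w) - p u w) * (of_bool (w = v) - p w v))
      = of_bool (u = v) - p u v" .
qed

lemma diag_le_1: "p u u \<le> 1"
  using projection_matrix.diag_nonneg[OF projection_matrix_complement, of u] by simp

lemma entry_square_le_complement: "u \<noteq> v \<Longrightarrow> (p u v)\<^sup>2 \<le> (1 - p u u) * (1 - p v v)"
  using projection_matrix.entry_square_le[OF projection_matrix_complement, of u v] by simp

lemma off_diagonal_row_sum: "(\<Sum>v\<in>- {u}. (p u v)\<^sup>2) = p u u * (1 - p u u)"
proof -
  have "(\<Sum>v\<in>UNIV. (p u v)\<^sup>2) = (p u u)\<^sup>2 + (\<Sum>v\<in>- {u}. (p u v)\<^sup>2)"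
    by (subst sum.remove[of UNIV u]) (simp_all add: Compl_eq_Diff_UNIV)
  then have "p u u = (p u u)\<^sup>2 + (\<Sum>v\<in>- {u}. (p u v)\<^sup>2)" by (simp add: row_sum_squares)
  then show ?thesis by (simp add: right_diff_distrib power2_eq_square[symmetric])
qed

lemma off_diagonal_weighted_sum:
  "(\<Sum>u\<in>UNIV. \<Sum>v\<in>- {u}. (p u v)\<^sup>2 * m u) = (\<Sum>u\<in>UNIV. p u u * (1 - p u u) * m u)"
  by (simp add: sum_distrib_right[symmetric] off_diagonal_row_sum)

lemma off_diagonal_weighted_sum':
  "(\<Sum>u\<in>UNIV. \<Sum>v\<in>- {u}. (p u v)\<^sup>2 * m v) = (\<Sum>u\<in>UNIV. p u u * (1 - p u u) * m u)"
proof -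
  have "(\<Sum>u\<in>UNIV. \<Sum>v\<in>- {u}. (p u v)\<^sup>2 * m v)
      = (\<Sum>(u, v)\<in>(SIGMA u:UNIV. - {u}). (p u v)\<^sup>2 * m v)"
    by (simp add: sum.Sigma)
  also have "\<dots> = (\<Sum>(v, u)\<in>(SIGMA v:UNIV. - {v}). (p v u)\<^sup>2 * m v)"
    by (rule sum.reindex_bij_witness[of _ prod.swap prod.swap]) (auto simp: sym)
  also have "\<dots> = (\<Sum>u\<in>UNIV. \<Sum>v\<in>- {u}. (p u v)\<^sup>2 * m u)"
    by (simp add: sum.Sigma)
  finally show ?thesis by (simp add: off_diagonal_weighted_sum)
qed

section \<open>Large and small vertices: bounds on the remainder\<close>

definition large :: "'v set" where "large = {u. 1/2 < p u u}"

text \<open>In a mixed pair only the small endpoint has \<open>1 - p u u\<close> at least 1/2. The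
  weight 2 of its large partner makes up for this.\<close>

definition weight :: "'v \<Rightarrow> real" where "weight u = (if u \<in> large then 2 else 1)"

text \<open>AM-GM gives the factor \<open>1 / (a * b)\<close>. It is split into terms in
  \<open>1 / a\<close> and \<open>1 / b\<close> alone because these cancel against the row sums
  \<open>p u u * (1 - p u u)\<close>.\<close>

lemma remainder_le_small:
  assumes "u \<noteq> v" "u \<notin> large \<or> v \<notin> large"
  shows "(p u v)\<^sup>2 - 2 * p u v - (1 - p u u) * (1 - p v v)
    \<le> (p u v)\<^sup>2 + (p u v)\<^sup>2 * (weight u / (1 - p u u)) + (p u v)\<^sup>2 * (weight v / (1 - p v v))"
proof -
  define a b where "a = 1 - p u u" and "b = 1 - p v v"
  have nonneg: "a \<ge> 0" "b \<ge> 0" and w: "weight u > 0" "weight v > 0"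
    using diag_le_1[of u] diag_le_1[of v] by (auto simp: a_def b_def weight_def)
  have sq: "(p u v)\<^sup>2 \<le> a * b" using entry_square_le_complement[OF assms(1)] by (simp add: a_def b_def)
  have "- 2 * p u v - a * b \<le> (p u v)\<^sup>2 * (weight u / a + weight v / b)"
  \<comment> \<open>In the degenerate case the minor bound forces \<open>p u v = 0\<close>, and both
    sides are 0.\<close>
  proof (cases "a = 0 \<or> b = 0")
    case True
    then have "p u v = 0" "a * b = 0" using sq by auto
    then show ?thesis by (simp only:) simp
  next
    case False
    then have pos: "a > 0" "b > 0" using nonneg by auto
    have "0 \<le> (p u v + a * b)\<^sup>2 / (a * b)" using pos by simp
    also have "\<dots> = (p u v)\<^sup>2 / (a * b) + 2 * p u v + a * b"
      using pos by (simp add: field_simps power2_eq_square)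
    finally have "- 2 * p u v - a * b \<le> (p u v)\<^sup>2 * (1 / (a * b))" by simp
    also have "\<dots> \<le> (p u v)\<^sup>2 * (weight u / a + weight v / b)"
    proof (rule mult_left_mono)
      \<comment> \<open>The weights are chosen so that this holds as soon as one of the two vertices is not large.\<close>
      have "1 \<le> weight u * b + weight v * a"
        using assms(2) nonneg by (auto simp: weight_def large_def a_def b_def)
      then show "1 / (a * b) \<le> weight u / a + weight v / b"
        using pos by (simp add: field_simps)
    qed simp
    finally show ?thesis .
  qed
  then show ?thesis by (simp add: a_def b_def algebra_simps)
qed

lemma remainder_le_large:
  assumes "u \<noteq> v"
  shows "(p u v)\<^sup>2 - 2 * p u v - (1 - p u u) * (1 - p v v) \<le> 2 * \<bar>p u v\<bar>"
  using entry_square_le_complement[OF assms] by linarith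

lemma card_large_less:
  assumes "(\<Sum>u\<in>UNIV. p u u) = real k" "1 \<le> k"
  shows "real (card large) \<le> 2 * real k - 1"
proof -
  \<comment> \<open>This is Markov's inequality for the trace \<open>k\<close> at threshold 1/2. It
    is strict, so integrality gives the bound \<open>2 k - 1\<close>.\<close>
  have "card large < 2 * k"
  proof (cases "large = {}")
    case False
    have "(\<Sum>u\<in>large. 1/2) < (\<Sum>u\<in>large. p u u)"
      by (rule sum_strict_mono) (use False in \<open>auto simp: large_def\<close>)
    also have "\<dots> \<le> (\<Sum>u\<in>UNIV. p u u)"
      by (rule sum_mono2) (auto simp: diag_nonneg)
    finally show ?thesis using assms(1) by simp
  qed (use assms(2) in simp)
  then show ?thesis by linarith
qed

text \<open>The row-sum identities, applied to rows and columns, turn the double sum into one over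
  single vertices in which the denominators cancel.\<close>

lemma small_sum_le:
  assumes tr: "(\<Sum>u\<in>UNIV. p u u) = real k" and k: "1 \<le> k"
  shows "(\<Sum>u\<in>UNIV. \<Sum>v\<in>- {u}. (p u v)\<^sup>2 + (p u v)\<^sup>2 * (weight u / (1 - p u u))
            + (p u v)\<^sup>2 * (weight v / (1 - p v v))) \<le> 5 * real k - 1"
proof -
  have "(\<Sum>u\<in>UNIV. \<Sum>v\<in>- {u}. (p u v)\<^sup>2 + (p u v)\<^sup>2 * (weight u / (1 - p u u))
            + (p u v)\<^sup>2 * (weight v / (1 - p v v)))
      = (\<Sum>u\<in>UNIV. p u u * (1 - p u u))
        + 2 * (\<Sum>u\<in>UNIV. p u u * (1 - p u u) * (weight u / (1 - p u u)))"
    using off_diagonal_weighted_sum[of "\<lambda>u. weight u / (1 - p u u)"]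
      off_diagonal_weighted_sum'[of "\<lambda>u. weight u / (1 - p u u)"]
      off_diagonal_weighted_sum[of "\<lambda>u. 1"]
    unfolding sum.distrib mult_1_right by linarith
  also have "\<dots> = (\<Sum>u\<in>UNIV. p u u * (1 - p u u)
      + 2 * (p u u * (1 - p u u) * (weight u / (1 - p u u))))"
    unfolding sum.distrib sum_distrib_left ..
  \<comment> \<open>With \<open>d = p u u\<close>, a small vertex gives at most
    \<open>d + 2 d\<close>, and a large one at most \<open>(1 - d) + 4 d = 3 d + 1\<close>.\<close>
  also have "\<dots> \<le> (\<Sum>u\<in>UNIV. 3 * p u u + of_bool (u \<in> large))"
  proof (rule sum_mono)
    fix u
    have d: "0 \<le> p u u" "p u u \<le> 1" by (auto simp: diag_nonneg diag_le_1)
    have "p u u * (1 - p u u) * (weight u / (1 - p u u)) \<le> p u u * weight u"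
      using d by (cases "p u u = 1") (auto simp: weight_def)
    moreover have "p u u * (1 - p u u) \<le> p u u" "p u u * (1 - p u u) \<le> 1 - p u u"
      using d by (auto intro: mult_left_le mult_left_le_one_le)
    ultimately show "p u u * (1 - p u u) + 2 * (p u u * (1 - p u u) * (weight u / (1 - p u u)))
        \<le> 3 * p u u + of_bool (u \<in> large)"
      by (auto simp: weight_def split: if_splits)
  qed
  also have "\<dots> = 3 * real k + real (card large)"
    by (simp add: sum.distrib sum_distrib_left[symmetric] tr)
  also have "\<dots> \<le> 5 * real k - 1" using card_large_less[OF tr k] by simp
  finally show ?thesis .
qed

text \<open>Cauchy-Schwarz over the ordered pairs of distinct large vertices: there are fewer than
  \<open>4 k\<^sup>2\<close> of them, and each row contributes at most \<open>p u u / 2\<close> to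
  the sum of squares, \<open>k / 2\<close> in total.\<close>

lemma large_sum_le:
  assumes tr: "(\<Sum>u\<in>UNIV. p u u) = real k" and k: "1 \<le> k"
  shows "(\<Sum>u\<in>large. \<Sum>v\<in>large - {u}. 2 * \<bar>p u v\<bar>) \<le> (4 * real k - 4) * sqrt (real k)"
proof -
  let ?S = "SIGMA u:large. large - {u}"
  let ?b = "real (card large)"
  have "card ?S = card large * (card large - 1)" by simp
  then have cardS: "real (card ?S) = ?b * (?b - 1)" by (cases "card large") (auto simp: algebra_simps)
  have "(\<Sum>(u, v)\<in>?S. (p u v)\<^sup>2) = (\<Sum>u\<in>large. \<Sum>v\<in>large - {u}. (p u v)\<^sup>2)"
    by (simp add: sum.Sigma)
  also have "\<dots> \<le> (\<Sum>u\<in>large. \<Sum>v\<in>- {u}. (p u v)\<^sup>2)"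
    by (intro sum_mono sum_mono2) auto
  also have "\<dots> \<le> (\<Sum>u\<in>large. p u u / 2)"
  proof (rule sum_mono)
    fix u assume "u \<in> large"
    then have "p u u * (1 - p u u) \<le> p u u * (1/2)"
      by (intro mult_left_mono) (auto simp: large_def)
    then show "(\<Sum>v\<in>- {u}. (p u v)\<^sup>2) \<le> p u u / 2" by (simp add: off_diagonal_row_sum)
  qed
  also have "\<dots> \<le> (\<Sum>u\<in>UNIV. p u u / 2)"
    by (rule sum_mono2) (auto simp: diag_nonneg)
  also have "\<dots> = real k / 2" by (simp add: sum_divide_distrib[symmetric] tr)
  finally have sq: "(\<Sum>(u, v)\<in>?S. (p u v)\<^sup>2) \<le> real k / 2" .
  have b: "?b \<le> 2 * real k - 1" by (rule card_large_less[OF tr k])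
  have "?b * (?b - 1) \<le> (2 * real k - 1) * (2 * real k - 2)"
  proof (cases "card large = 0")
    case False
    then have "1 \<le> ?b" by linarith
    then show ?thesis using b by (intro mult_mono) linarith+
  qed (use k in simp)
  \<comment> \<open>This form makes the product with \<open>k / 2\<close> a perfect square. For
    \<open>k = 1\<close> both sides vanish; for \<open>k \<ge> 2\<close> one has
    \<open>2 k - 1 \<le> 2 (2 k - 2)\<close>.\<close>
  also have "\<dots> \<le> 2 * (2 * real k - 2)\<^sup>2"
  proof (cases "k = 1")
    case False
    then have "real k \<ge> 2" using k by linarith
    then have "(2 * real k - 1) * (2 * real k - 2) \<le> (2 * (2 * real k - 2)) * (2 * real k - 2)"
      by (intro mult_right_mono) auto
    then show ?thesis by (simp only: power2_eq_square mult.assoc)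
  qed simp
  finally have cnt: "?b * (?b - 1) \<le> 2 * (2 * real k - 2)\<^sup>2" .
  have "(\<Sum>(u, v)\<in>?S. \<bar>p u v\<bar>)\<^sup>2 \<le> (\<Sum>(u, v)\<in>?S. (p u v)\<^sup>2) * real (card ?S)"
    using Cauchy_Schwarz_ineq_sum[of "\<lambda>(u, v). \<bar>p u v\<bar>" "\<lambda>_. 1" ?S]
    by (simp add: case_prod_beta)
  also have "\<dots> \<le> (real k / 2) * (2 * (2 * real k - 2)\<^sup>2)"
    using sq cnt unfolding cardS[symmetric] by (intro mult_mono) auto
  also have "\<dots> = ((2 * real k - 2) * sqrt (real k))\<^sup>2"
    by (simp add: power_mult_distrib)
  finally have "(\<Sum>(u, v)\<in>?S. \<bar>p u v\<bar>) \<le> (2 * real k - 2) * sqrt (real k)"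
    by (rule power2_le_imp_le) (use k in simp)
  moreover have "(\<Sum>u\<in>large. \<Sum>v\<in>large - {u}. 2 * \<bar>p u v\<bar>) = 2 * (\<Sum>(u, v)\<in>?S. \<bar>p u v\<bar>)"
    by (simp add: sum.Sigma sum_distrib_left[symmetric])
  ultimately show ?thesis by (simp add: algebra_simps)
qed

text \<open>Sums run over ordered pairs, so the bound is twice the one sought for the
  excess.\<close>

lemma adjacency_sum_le:
  assumes tr: "(\<Sum>u\<in>UNIV. p u u) = real k" and k: "1 \<le> k"
    and irrefl: "\<And>u. \<not> A u u"
  shows "(\<Sum>u\<in>UNIV. \<Sum>v\<in>UNIV. of_bool (A u v) * (p u u + p v v - 1 - 2 * p u v))
    \<le> real k * (real k - 1) + (8 * real k - 4) * sqrt (real k)"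
proof -
  define r where "r u v = (p u v)\<^sup>2 - 2 * p u v - (1 - p u u) * (1 - p v v)" for u v
  define h where "h u v = (p u v)\<^sup>2 + (p u v)\<^sup>2 * (weight u / (1 - p u u))
      + (p u v)\<^sup>2 * (weight v / (1 - p v v))" for u v
  define g where "g u v = (if u \<in> large \<and> v \<in> large then 2 * \<bar>p u v\<bar> else 0)" for u v
  have h_nonneg: "0 \<le> h u v" for u v
    unfolding h_def by (auto simp: weight_def diag_le_1)
  \<comment> \<open>The products sum to the squared trace \<open>k\<^sup>2\<close>, the squares to
    the trace \<open>k\<close>.\<close>
  have minors: "(\<Sum>u\<in>UNIV. \<Sum>v\<in>UNIV. p u u * p v v - (p u v)\<^sup>2) = real k * (real k - 1)"
    by (simp add: sum_subtractf row_sum_squares sum_product[symmetric] tr algebra_simps)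
  \<comment> \<open>The right side is nonnegative and does not mention \<open>A\<close>, so the sum
    over adjacent pairs extends to all pairs.\<close>
  have entry: "of_bool (A u v) * (p u u + p v v - 1 - 2 * p u v)
      \<le> (p u u * p v v - (p u v)\<^sup>2) + of_bool (u \<noteq> v) * (h u v + g u v)" for u v
  proof (cases "A u v")
    case True
    then have "u \<noteq> v" using irrefl by auto
    moreover have "r u v \<le> h u v + g u v"
      using remainder_le_small[OF \<open>u \<noteq> v\<close>] remainder_le_large[OF \<open>u \<noteq> v\<close>] h_nonneg[of u v]
      unfolding r_def g_def h_def[symmetric] by (auto split: if_splits)
    ultimately show ?thesis using True by (simp add: r_def algebra_simps)
  next
    case False
    have "0 \<le> g u v" by (simp add: g_def)
    with False show ?thesis using entry_square_le[of u v] h_nonneg[of u v] by auto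
  qed
  have off: "(\<Sum>v\<in>UNIV. of_bool (u \<noteq> v) * f v) = (\<Sum>v\<in>- {u}. f v)" for u and f :: "'v \<Rightarrow> real"
    by (rule sum.mono_neutral_cong_right) auto
  have "(\<Sum>u\<in>UNIV. \<Sum>v\<in>- {u}. g u v) = (\<Sum>u\<in>large. \<Sum>v\<in>- {u}. g u v)"
    by (rule sum.mono_neutral_right) (auto simp: g_def)
  also have "\<dots> = (\<Sum>u\<in>large. \<Sum>v\<in>large - {u}. 2 * \<bar>p u v\<bar>)"
    by (intro sum.cong refl sum.mono_neutral_cong_right) (auto simp: g_def)
  finally have g_le: "(\<Sum>u\<in>UNIV. \<Sum>v\<in>- {u}. g u v) \<le> (4 * real k - 4) * sqrt (real k)"
    using large_sum_le[OF tr k] by simp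
  have "(\<Sum>u\<in>UNIV. \<Sum>v\<in>UNIV. of_bool (A u v) * (p u u + p v v - 1 - 2 * p u v))
      \<le> (\<Sum>u\<in>UNIV. \<Sum>v\<in>UNIV. (p u u * p v v - (p u v)\<^sup>2) + of_bool (u \<noteq> v) * (h u v + g u v))"
    by (intro sum_mono entry)
  also have "\<dots> = real k * (real k - 1) + (\<Sum>u\<in>UNIV. \<Sum>v\<in>- {u}. h u v)
      + (\<Sum>u\<in>UNIV. \<Sum>v\<in>- {u}. g u v)"
    by (simp only: sum.distrib minors off)
  also have "\<dots> \<le> real k * (real k - 1) + (5 * real k - 1) + (4 * real k - 4) * sqrt (real k)"
    using small_sum_le[OF tr k] g_le unfolding h_def by linarith
  \<comment> \<open>With \<open>s = sqrt k\<close> the two sides differ by \<open>4 s\<^sup>3 - 5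
    s\<^sup>2 + 1 = (s - 1) (4 s\<^sup>2 - s - 1)\<close>, which is nonnegative for
    \<open>s \<ge> 1\<close>.\<close>
  also have "\<dots> \<le> real k * (real k - 1) + (8 * real k - 4) * sqrt (real k)"
  proof -
    define s where "s = sqrt (real k)"
    have s: "real k = s\<^sup>2" "s \<ge> 1" using k by (auto simp: s_def)
    then have "s * s \<ge> s" by simp
    then have "0 \<le> 4 * (s * s) - s - 1" using s(2) by linarith
    then have "0 \<le> (s - 1) * (4 * (s * s) - s - 1)" using s(2) by simp
    then show ?thesis unfolding s_def[symmetric] s(1) using s(2) by (simp add: power2_eq_square algebra_simps)
  qed
  finally show ?thesis .
qed

end

section \<open>The Laplacian quadratic form\<close>

lemma graph_degree_eq_sum:
  assumes "simple_graph E"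
  shows "real (graph_degree E u) = (\<Sum>v\<in>UNIV. of_bool (u \<noteq> v \<and> {u, v} \<in> E))"
proof -
  have "bij_betw (\<lambda>v. {u, v}) {v. u \<noteq> v \<and> {u, v} \<in> E} {e \<in> E. u \<in> e}"
    unfolding bij_betw_def
  proof
    show "inj_on (\<lambda>v. {u, v}) {v. u \<noteq> v \<and> {u, v} \<in> E}" by (auto simp: inj_on_def doubleton_eq_iff)
    show "(\<lambda>v. {u, v}) ` {v. u \<noteq> v \<and> {u, v} \<in> E} = {e \<in> E. u \<in> e}"
    proof (intro equalityI subsetI)
      fix e assume e: "e \<in> {e \<in> E. u \<in> e}"
      then have "card e = 2" using assms by (auto simp: simple_graph_def)
      then obtain a b where "e = {a, b}" "a \<noteq> b" by (auto simp: card_2_iff)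
      with e show "e \<in> (\<lambda>v. {u, v}) ` {v. u \<noteq> v \<and> {u, v} \<in> E}" by (auto simp: insert_commute)
    qed auto
  qed
  then have "graph_degree E u = card {v. u \<noteq> v \<and> {u, v} \<in> E}"
    unfolding graph_degree_def using bij_betw_same_card[symmetric] by blast
  then show ?thesis by simp
qed

text \<open>Handshake lemma: incidences are counted by vertices and by edges.\<close>

lemma sum_graph_degree:
  assumes "simple_graph E"
  shows "(\<Sum>u\<in>UNIV. graph_degree E u) = 2 * card E"
proof -
  have "(\<Sum>u\<in>UNIV. graph_degree E u) = (\<Sum>u\<in>UNIV. \<Sum>e\<in>E. of_bool (u \<in> e))"
    by (simp add: graph_degree_def Int_def)
  also have "\<dots> = (\<Sum>e\<in>E. \<Sum>u\<in>UNIV. of_bool (u \<in> e))" by (rule sum.swap)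
  also have "\<dots> = (\<Sum>e\<in>E. 2)"
    using assms by (intro sum.cong) (auto simp: simple_graph_def)
  finally show ?thesis by simp
qed

lemma transpose_laplacian: "transpose (laplacian E) = laplacian E"
  by (simp add: transpose_def laplacian_def vec_eq_iff insert_commute)

text \<open>Each degree expands into a sum over neighbours, and symmetry of adjacency trades
  \<open>p u u\<close> for \<open>p v v\<close>. The factor 2 arises because every edge is met as
  two ordered pairs.\<close>

lemma laplacian_trace_eq:
  fixes p :: "'v::finite \<Rightarrow> 'v \<Rightarrow> real"
  assumes E: "simple_graph E"
  shows "2 * ((\<Sum>u\<in>UNIV. \<Sum>v\<in>UNIV. laplacian E $ u $ v * p u v) - real (card E))
    = (\<Sum>u\<in>UNIV. \<Sum>v\<in>UNIV. of_bool (u \<noteq> v \<and> {u, v} \<in> E) * (p u u + p v v - 1 - 2 * p u v))"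
proof -
  define A :: "'v \<Rightarrow> 'v \<Rightarrow> real" where "A u v = of_bool (u \<noteq> v \<and> {u, v} \<in> E)" for u v
  have deg: "real (graph_degree E u) = (\<Sum>v\<in>UNIV. A u v)" for u
    unfolding A_def by (rule graph_degree_eq_sum[OF E])
  have A_sym: "A u v = A v u" for u v by (auto simp: A_def insert_commute)
  have "laplacian E $ u $ v * p u v = (if v = u then real (graph_degree E u) * p u u else 0) - A u v * p u v" for u v
    by (auto simp: laplacian_def A_def)
  then have "(\<Sum>u\<in>UNIV. \<Sum>v\<in>UNIV. laplacian E $ u $ v * p u v)
      = (\<Sum>u\<in>UNIV. \<Sum>v\<in>UNIV. A u v * p u u) - (\<Sum>u\<in>UNIV. \<Sum>v\<in>UNIV. A u v * p u v)"
    by (simp add: sum_subtractf deg sum_distrib_right)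
  moreover have "2 * real (card E) = (\<Sum>u\<in>UNIV. \<Sum>v\<in>UNIV. A u v)"
    using sum_graph_degree[OF E] unfolding deg[symmetric] by (metis of_nat_sum of_nat_mult of_nat_numeral)
  moreover have "(\<Sum>u\<in>UNIV. \<Sum>v\<in>UNIV. A u v * p v v) = (\<Sum>u\<in>UNIV. \<Sum>v\<in>UNIV. A u v * p u u)"
    by (subst sum.swap) (simp add: A_sym)
  moreover have "(\<Sum>u\<in>UNIV. \<Sum>v\<in>UNIV. A u v * (p u u + p v v - 1 - 2 * p u v))
      = (\<Sum>u\<in>UNIV. \<Sum>v\<in>UNIV. A u v * p u u) + (\<Sum>u\<in>UNIV. \<Sum>v\<in>UNIV. A u v * p v v)
        - (\<Sum>u\<in>UNIV. \<Sum>v\<in>UNIV. A u v) - 2 * (\<Sum>u\<in>UNIV. \<Sum>v\<in>UNIV. A u v * p u v)"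
    by (simp add: sum_distrib_left algebra_simps sum.distrib sum_subtractf)
  ultimately show ?thesis unfolding A_def[symmetric] by simp
qed

section \<open>The top eigenvalues as a trace, and the final bound\<close>

lemma sum_eigval_eq_trace:
  fixes M :: "real ^ 'n ^ 'n"
  assumes "transpose M = M" and k: "k \<le> CARD('n)"
  obtains p where "projection_matrix p" "(\<Sum>u\<in>UNIV. p u u) = real k"
    "(\<Sum>i=1..k. eigval i M) = (\<Sum>u\<in>UNIV. \<Sum>v\<in>UNIV. M $ u $ v * p u v)"
proof -
  obtain x :: "nat \<Rightarrow> real ^ 'n" where
    orth: "\<And>i j. i < CARD('n) \<Longrightarrow> j < CARD('n) \<Longrightarrow> x i \<bullet> x j = of_bool (i = j)" and
    eig: "\<And>i. i < CARD('n) \<Longrightarrow> M *v x i = eigval (Suc i) M *\<^sub>R x i"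
    using symmetric_eigval_orthonormal[OF assms(1)] by blast
  \<comment> \<open>This is the sum of the rank-one projections onto the first \<open>k\<close>
    eigenvectors; orthonormality gives idempotence and trace \<open>k\<close>.\<close>
  define p where "p u v = (\<Sum>i<k. x i $ u * x i $ v)" for u v
  have orth': "(\<Sum>w\<in>UNIV. x i $ w * x j $ w) = of_bool (i = j)" if "i < k" "j < k" for i j
    using orth[of i j] that k by (simp add: inner_vec_def)
  have "projection_matrix p"
  proof
    fix u v
    show "p u v = p v u" by (simp add: p_def mult.commute)
    have "(\<Sum>w\<in>UNIV. p u w * p w v)
        = (\<Sum>w\<in>UNIV. \<Sum>i<k. \<Sum>j<k. x i $ u * x j $ v * (x i $ w * x j $ w))"
      by (simp add: p_def sum_product algebra_simps)
    also have "\<dots> = (\<Sum>i<k. \<Sum>j<k. \<Sum>w\<in>UNIV. x i $ u * x j $ v * (x i $ w * x j $ w))"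
      by (subst sum.swap) (intro sum.cong refl sum.swap)
    also have "\<dots> = (\<Sum>i<k. \<Sum>j<k. x i $ u * x j $ v * of_bool (i = j))"
      by (intro sum.cong refl) (simp add: sum_distrib_left[symmetric] orth')
    also have "\<dots> = (\<Sum>i<k. \<Sum>j<k. if i = j then x i $ u * x j $ v else 0)"
      by (intro sum.cong) auto
    also have "\<dots> = p u v"
      by (simp add: p_def)
    finally show "(\<Sum>w\<in>UNIV. p u w * p w v) = p u v" .
  qed
  moreover have "(\<Sum>u\<in>UNIV. p u u) = real k"
    unfolding p_def by (subst sum.swap) (simp add: orth')
  moreover have "(\<Sum>i=1..k. eigval i M) = (\<Sum>u\<in>UNIV. \<Sum>v\<in>UNIV. M $ u $ v * p u v)"
  proof -
    have "(\<Sum>i=1..k. eigval i M) = (\<Sum>i<k. eigval (Suc i) M)"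
      by (rule sum.reindex_bij_witness[of _ Suc "\<lambda>i. i - 1"]) auto
    \<comment> \<open>The Rayleigh quotient of a unit eigenvector is its eigenvalue. Expanding it in
      coordinates produces the trace of \<open>M\<close> times \<open>p\<close>.\<close>
    also have "\<dots> = (\<Sum>i<k. x i \<bullet> (M *v x i))"
      using k by (intro sum.cong) (auto simp: eig orth)
    also have "\<dots> = (\<Sum>i<k. \<Sum>u\<in>UNIV. \<Sum>v\<in>UNIV. M $ u $ v * (x i $ u * x i $ v))"
      by (simp add: inner_vec_def matrix_vector_mult_def sum_distrib_left algebra_simps)
    also have "\<dots> = (\<Sum>u\<in>UNIV. \<Sum>v\<in>UNIV. \<Sum>i<k. M $ u $ v * (x i $ u * x i $ v))"
      by (subst sum.swap) (intro sum.cong refl sum.swap)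
    finally show ?thesis by (simp add: p_def sum_distrib_left)
  qed
  ultimately show thesis using that by blast
qed

theorem theorem1p3:
  fixes E :: "'v::finite set set" and k :: nat
  assumes "simple_graph E"
    and "1 \<le> k" and "k \<le> CARD('v)"
  shows "lap_excess k E \<le> real (k choose 2) + (4 * real k - 2) * sqrt (real k)"
proof -
  obtain p where p: "projection_matrix p" "(\<Sum>u\<in>UNIV. p u u) = real k"
    "(\<Sum>i=1..k. eigval i (laplacian E)) = (\<Sum>u\<in>UNIV. \<Sum>v\<in>UNIV. laplacian E $ u $ v * p u v)"
    using sum_eigval_eq_trace[OF transpose_laplacian assms(3)] by blast
  have "2 * lap_excess k E
      = (\<Sum>u\<in>UNIV. \<Sum>v\<in>UNIV. of_bool (u \<noteq> v \<and> {u, v} \<in> E) * (p u u + p v v - 1 - 2 * p u v))"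
    unfolding lap_excess_def p(3) by (rule laplacian_trace_eq[OF assms(1)])
  also have "\<dots> \<le> real k * (real k - 1) + (8 * real k - 4) * sqrt (real k)"
    by (rule projection_matrix.adjacency_sum_le[OF p(1,2) assms(2)]) simp
  finally have "2 * lap_excess k E \<le> real k * (real k - 1) + (8 * real k - 4) * sqrt (real k)" .
  \<comment> \<open>The identity is proved over the naturals, where subtraction is truncated;
    \<open>1 \<le> k\<close> makes the cast of \<open>k - 1\<close> exact.\<close>
  moreover have "2 * real (k choose 2) = real k * (real k - 1)"
  proof -
    have "2 * (k choose 2) = k * (k - 1)"
      unfolding choose_two by (rule dvd_mult_div_cancel) (cases k; simp)
    then have "2 * real (k choose 2) = real (k * (k - 1))" by (metis of_nat_mult of_nat_numeral)
    then show ?thesis using assms(2) by (simp add: of_nat_diff)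
  qed
  ultimately show ?thesis by (simp add: algebra_simps)
qed

end
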